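(* Let $\epsilon_1,\epsilon_2\in\{+,-\}$ and suppose that $m^{\epsilon_1}\not\equiv0$ and $n^{\epsilon_2}\not\equiv0$ on $[T_1,T_2]$. Then at least one of the two intersections $C_1^>\cap(\mathbb{R}_{\epsilon_1}\times\mathbb{R}_{\epsilon_2})$ and $C_1^<\cap(\mathbb{R}_{\epsilon_1}\times\mathbb{R}_{\epsilon_2})$ is nonempty.
   Context: Let $T_1<T_2$ be real numbers, $p,q,m,n\in C[T_1,T_2]$ with $p(t)>0$ and $q(t)\ge 0$ on $[T_1,T_2]$, $m\not\equiv 0$, $n\not\equiv0$, and $Lu:=-[p(t)u']'+q(t)u$. For a function $w$, write $w^\pm:=\max\{\pm w,0\}$; $\mathbb{R}_+=[0,+\infty[$, $\mathbb{R}_-=\,]-\infty,0]$. Consider the problem $$Lu=a\,m(t)u^+-b\,n(t)u^-\ \text{in } ]T_1,T_2[,\qquad u'(T_1)=0=u'(T_2).\qquad(P)$$ $C_1^>$ (resp. $C_1^<$) is the set of $(a,b)\in\mathbb{R}^2$ such that $(P)$ has a nontrivial solution with exactly one zero in $]T_1,T_2[$ and with $u(T_2)>0$ (resp. $u(T_2)<0$). *)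

theory Defs
  imports Complex_Main
begin

datatype pm_sign = SPlus | SMinus

primrec signed_part :: "pm_sign \<Rightarrow> real \<Rightarrow> real" where
  "signed_part SPlus x = max x 0"
| "signed_part SMinus x = max (- x) 0"

primrec signed_half_line :: "pm_sign \<Rightarrow> real set" where
  "signed_half_line SPlus = {0..}"
| "signed_half_line SMinus = {..0}"

text \<open>Classical solutions: \<open>u\<close> is continuously differentiable on the closed interval (one-sided
  derivatives at the end points), while \<open>p\<close> is merely continuous, so that only \<open>u'\<close> and the
  derivative \<open>w\<close> of the product \<open>p u'\<close> are required to exist, not \<open>u''\<close>.\<close>

definition neumann_solution ::
  "real \<Rightarrow> real \<Rightarrow> (real \<Rightarrow> real) \<Rightarrow> (real \<Rightarrow> real) \<Rightarrow> (real \<Rightarrow> real) \<Rightarrow> (real \<Rightarrow> real)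
    \<Rightarrow> real \<Rightarrow> real \<Rightarrow> (real \<Rightarrow> real) \<Rightarrow> bool" where
  "neumann_solution T1 T2 p q m n a b u \<longleftrightarrow>
    (\<exists>u' w.
      (\<forall>t\<in>{T1..T2}. (u has_real_derivative u' t) (at t within {T1..T2})) \<and>
      continuous_on {T1..T2} u' \<and>
      (\<forall>t\<in>{T1<..<T2}. ((\<lambda>s. p s * u' s) has_real_derivative w t) (at t)) \<and>
      (\<forall>t\<in>{T1<..<T2}. - w t + q t * u t =
        a * m t * signed_part SPlus (u t) - b * n t * signed_part SMinus (u t)) \<and>
      u' T1 = 0 \<and> u' T2 = 0)"

definition one_zero_solution ::
  "real \<Rightarrow> real \<Rightarrow> (real \<Rightarrow> real) \<Rightarrow> (real \<Rightarrow> real) \<Rightarrow> (real \<Rightarrow> real) \<Rightarrow> (real \<Rightarrow> real)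
    \<Rightarrow> real \<Rightarrow> real \<Rightarrow> (real \<Rightarrow> real) \<Rightarrow> bool" where
  "one_zero_solution T1 T2 p q m n a b u \<longleftrightarrow>
    neumann_solution T1 T2 p q m n a b u \<and>
    (\<exists>t\<in>{T1..T2}. u t \<noteq> 0) \<and>
    (\<exists>!t. t \<in> {T1<..<T2} \<and> u t = 0)"

definition C1_gt ::
  "real \<Rightarrow> real \<Rightarrow> (real \<Rightarrow> real) \<Rightarrow> (real \<Rightarrow> real) \<Rightarrow> (real \<Rightarrow> real) \<Rightarrow> (real \<Rightarrow> real)
    \<Rightarrow> (real \<times> real) set" where
  "C1_gt T1 T2 p q m n = {(a, b). \<exists>u. one_zero_solution T1 T2 p q m n a b u \<and> u T2 > 0}"

definition C1_lt ::
  "real \<Rightarrow> real \<Rightarrow> (real \<Rightarrow> real) \<Rightarrow> (real \<Rightarrow> real) \<Rightarrow> (real \<Rightarrow> real) \<Rightarrow> (real \<Rightarrow> real)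
    \<Rightarrow> (real \<times> real) set" where
  "C1_lt T1 T2 p q m n = {(a, b). \<exists>u. one_zero_solution T1 T2 p q m n a b u \<and> u T2 < 0}"

end

theory Submission
  imports Defs "HOL-Analysis.Analysis"
begin

text \<open>Multiplying \<open>m\<close>, \<open>a\<close> by \<open>\<epsilon>1\<close> and \<open>n\<close>, \<open>b\<close> by \<open>\<epsilon>2\<close> reduces to nonnegative
  parameters. The signed weights are positive at two distinct points; put the zero \<open>c\<close> strictly
  between them. If the point for \<open>n\<close> lies on the left, then \<open>- u\<close> on \<open>[T1, c]\<close> and \<open>u\<close> on
  \<open>[c, T2]\<close> are to be positive solutions of linear problems with a Neumann condition at the outer end
  and a Dirichlet condition at \<open>c\<close>; they exist for suitable \<open>b\<close> and \<open>a\<close>, and since they may be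
  rescaled their derivatives can be matched at \<open>c\<close>. In the other case exchange the roles of \<open>m\<close> and
  \<open>n\<close> and replace \<open>u\<close> by \<open>- u\<close>. A principal eigenfunction with a weight that is positive somewhere
  is obtained by shooting from the Neumann end: the solution is positive for \<open>a = 0\<close>, vanishes
  somewhere for large \<open>a\<close>, and at the infimum of the parameters with a zero that zero can only be
  the Dirichlet end, because an interior one would be double.\<close>

section \<open>Monotonicity and comparison through derivatives\<close>

lemma nonneg_deriv_le:
  fixes f f' :: "real \<Rightarrow> real"
  assumes "s \<le> t" "s \<in> {\<alpha>..\<beta>}" "t \<in> {\<alpha>..\<beta>}"
    and der: "\<And>r. r \<in> {\<alpha>..\<beta>} \<Longrightarrow> (f has_real_derivative f' r) (at r within {\<alpha>..\<beta>})"
    and nonneg: "\<And>r. r \<in> {\<alpha>..\<beta>} \<Longrightarrow> 0 \<le> f' r"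
  shows "f s \<le> f t"
proof (rule DERIV_nonneg_imp_increasing_open[OF \<open>s \<le> t\<close>])
  show "\<exists>y. (f has_real_derivative y) (at r) \<and> 0 \<le> y" if "s < r" "r < t" for r
  proof (intro exI conjI)
    have "r \<in> {\<alpha><..<\<beta>}" using that assms(2,3) by auto
    then show "(f has_real_derivative f' r) (at r)"
      using der[of r] at_within_interior[of r "{\<alpha>..\<beta>}"] by auto
    show "0 \<le> f' r" using nonneg[of r] that assms(2,3) by auto
  qed
  have "continuous_on {\<alpha>..\<beta>} f"
    using der DERIV_continuous by (metis continuous_on_eq_continuous_within)
  then show "continuous_on {s..t} f"
    by (rule continuous_on_subset) (use assms(2,3) in auto)
qed

text \<open>Both \<open>g - f\<close> and \<open>g + f\<close> vanish at \<alpha> and have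
  nonnegative derivatives.\<close>

lemma abs_le_of_abs_deriv_le:
  fixes f g f' g' :: "real \<Rightarrow> real"
  assumes "t \<in> {\<alpha>..\<beta>}" "f \<alpha> = 0" "g \<alpha> = 0"
    and f: "\<And>r. r \<in> {\<alpha>..\<beta>} \<Longrightarrow> (f has_real_derivative f' r) (at r within {\<alpha>..\<beta>})"
    and g: "\<And>r. r \<in> {\<alpha>..\<beta>} \<Longrightarrow> (g has_real_derivative g' r) (at r within {\<alpha>..\<beta>})"
    and le: "\<And>r. r \<in> {\<alpha>..\<beta>} \<Longrightarrow> \<bar>f' r\<bar> \<le> g' r"
  shows "\<bar>f t\<bar> \<le> g t"
proof -
  have "g \<alpha> - f \<alpha> \<le> g t - f t"
    by (rule nonneg_deriv_le[where f = "\<lambda>r. g r - f r" and f' = "\<lambda>r. g' r - f' r" and \<alpha> = \<alpha> and \<beta> = \<beta>])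
      (use assms(1) le in \<open>auto intro!: DERIV_diff f g simp: abs_le_iff\<close>)
  moreover have "g \<alpha> + f \<alpha> \<le> g t + f t"
  proof (rule nonneg_deriv_le[where f = "\<lambda>r. g r + f r" and f' = "\<lambda>r. g' r + f' r" and \<alpha> = \<alpha> and \<beta> = \<beta>])
    show "0 \<le> g' r + f' r" if "r \<in> {\<alpha>..\<beta>}" for r using le[OF that] by linarith
  qed (use assms(1) in \<open>auto intro!: DERIV_add f g\<close>)
  ultimately show ?thesis using assms(2,3) by linarith
qed

section \<open>The initial value problem for the linear system\<close>

text \<open>With \<open>A = 1 / p\<close>, \<open>x = u\<close> and \<open>y = p u'\<close> this is the equation \<open>(p u')' = B u\<close>.\<close>

definition linear_system ::
  "(real \<Rightarrow> real) \<Rightarrow> (real \<Rightarrow> real) \<Rightarrow> real \<Rightarrow> real \<Rightarrow> (real \<Rightarrow> real) \<Rightarrow> (real \<Rightarrow> real) \<Rightarrow> bool" where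
  "linear_system A B \<alpha> \<beta> x y \<longleftrightarrow> (\<forall>t\<in>{\<alpha>..\<beta>}.
     (x has_real_derivative A t * y t) (at t within {\<alpha>..\<beta>}) \<and>
     (y has_real_derivative B t * x t) (at t within {\<alpha>..\<beta>}))"

lemma linear_systemD:
  assumes "linear_system A B \<alpha> \<beta> x y" "t \<in> {\<alpha>..\<beta>}"
  shows "(x has_real_derivative A t * y t) (at t within {\<alpha>..\<beta>})"
    and "(y has_real_derivative B t * x t) (at t within {\<alpha>..\<beta>})"
  using assms by (auto simp: linear_system_def)

lemma linear_system_continuous:
  assumes "linear_system A B \<alpha> \<beta> x y"
  shows "continuous_on {\<alpha>..\<beta>} x" and "continuous_on {\<alpha>..\<beta>} y"
  using linear_systemD[OF assms] DERIV_continuous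
  by (metis continuous_on_eq_continuous_within)+

text \<open>These are the increments of the Picard iteration, not the iterates: the solution with
  initial data \<open>(1, 0)\<close> is the sum of the series of these pairs.\<close>

primrec picard ::
  "(real \<Rightarrow> real) \<Rightarrow> (real \<Rightarrow> real) \<Rightarrow> real \<Rightarrow> nat \<Rightarrow> (real \<Rightarrow> real) \<times> (real \<Rightarrow> real)" where
  "picard A B \<alpha> 0 = (\<lambda>_. 1, \<lambda>_. 0)"
| "picard A B \<alpha> (Suc n) =
    (\<lambda>t. integral {\<alpha>..t} (\<lambda>s. A s * snd (picard A B \<alpha> n) s),
     \<lambda>t. integral {\<alpha>..t} (\<lambda>s. B s * fst (picard A B \<alpha> n) s))"

lemma picard_continuous:
  assumes "continuous_on {\<alpha>..\<beta>} A" "continuous_on {\<alpha>..\<beta>} B"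
  shows "continuous_on {\<alpha>..\<beta>} (fst (picard A B \<alpha> n)) \<and> continuous_on {\<alpha>..\<beta>} (snd (picard A B \<alpha> n))"
  by (induction n)
    (auto intro!: continuous_intros indefinite_integral_continuous_1 integrable_continuous_interval assms)

lemma picard_derivative:
  assumes "continuous_on {\<alpha>..\<beta>} A" "continuous_on {\<alpha>..\<beta>} B" "t \<in> {\<alpha>..\<beta>}"
  shows "(fst (picard A B \<alpha> (Suc n)) has_real_derivative A t * snd (picard A B \<alpha> n) t) (at t within {\<alpha>..\<beta>})"
    and "(snd (picard A B \<alpha> (Suc n)) has_real_derivative B t * fst (picard A B \<alpha> n) t) (at t within {\<alpha>..\<beta>})"
  using assms picard_continuous[OF assms(1,2), of n]
  by (auto intro!: integral_has_real_derivative continuous_on_mult)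

text \<open>A common bound \<open>C\<close> for both coefficients lets the two components share one
  majorant; the derivative of each majorant is \<open>C\<close> times the preceding one, which
  drives the induction.\<close>

lemma picard_bound:
  assumes cont: "continuous_on {\<alpha>..\<beta>} A" "continuous_on {\<alpha>..\<beta>} B"
    and bound: "\<And>t. t \<in> {\<alpha>..\<beta>} \<Longrightarrow> \<bar>A t\<bar> \<le> C" "\<And>t. t \<in> {\<alpha>..\<beta>} \<Longrightarrow> \<bar>B t\<bar> \<le> C"
    and "t \<in> {\<alpha>..\<beta>}"
  shows "\<bar>fst (picard A B \<alpha> n) t\<bar> \<le> (C * (t - \<alpha>)) ^ n / fact n \<and>
         \<bar>snd (picard A B \<alpha> n) t\<bar> \<le> (C * (t - \<alpha>)) ^ n / fact n"
  using \<open>t \<in> {\<alpha>..\<beta>}\<close>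
proof (induction n arbitrary: t)
  case 0
  then show ?case by simp
next
  case (Suc n)
  have g: "((\<lambda>r. (C * (r - \<alpha>)) ^ Suc n / fact (Suc n)) has_real_derivative
      C * ((C * (r - \<alpha>)) ^ n / fact n)) (at r within {\<alpha>..\<beta>})" for r
    by (rule derivative_eq_intros refl | simp)+
  have "\<bar>A r * snd (picard A B \<alpha> n) r\<bar> \<le> C * ((C * (r - \<alpha>)) ^ n / fact n)"
    "\<bar>B r * fst (picard A B \<alpha> n) r\<bar> \<le> C * ((C * (r - \<alpha>)) ^ n / fact n)"
    if "r \<in> {\<alpha>..\<beta>}" for r
    using bound(1)[OF that] bound(2)[OF that] Suc.IH[OF that]
    unfolding abs_mult by (intro mult_mono; simp)+
  then show ?case
    using abs_le_of_abs_deriv_le[OF Suc.prems _ _ picard_derivative(1)[OF cont] g]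
      abs_le_of_abs_deriv_le[OF Suc.prems _ _ picard_derivative(2)[OF cont] g]
    by auto
qed

text \<open>The majorants of the increments are the terms of an exponential series, so the series of
  derivatives converges uniformly and the sum of the increments may be differentiated term by
  term.\<close>

lemma linear_system_exists:
  assumes "\<alpha> \<le> \<beta>" and cont: "continuous_on {\<alpha>..\<beta>} A" "continuous_on {\<alpha>..\<beta>} B"
  shows "\<exists>x y. linear_system A B \<alpha> \<beta> x y \<and> x \<alpha> = 1 \<and> y \<alpha> = 0"
proof -
  let ?I = "{\<alpha>..\<beta>}"
  define f g where "f n = fst (picard A B \<alpha> n)" and "g n = snd (picard A B \<alpha> n)" for n
  obtain C where C: "\<And>t. t \<in> ?I \<Longrightarrow> \<bar>A t\<bar> \<le> C" "\<And>t. t \<in> ?I \<Longrightarrow> \<bar>B t\<bar> \<le> C"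
  proof -
    have "bounded (A ` ?I)" "bounded (B ` ?I)"
      using cont by (auto intro!: compact_imp_bounded compact_continuous_image)
    then obtain C1 C2 where "\<forall>t\<in>?I. \<bar>A t\<bar> \<le> C1" "\<forall>t\<in>?I. \<bar>B t\<bar> \<le> C2"
      unfolding bounded_iff by auto
    then show thesis by (intro that[of "max C1 C2"]) (auto simp: le_max_iff_disj)
  qed
  define M where "M n = (C * (\<beta> - \<alpha>)) ^ n / fact n" for n
  have "0 \<le> C" using C(1)[of \<alpha>] \<open>\<alpha> \<le> \<beta>\<close> by auto
  have bound: "\<bar>f n t\<bar> \<le> M n" "\<bar>g n t\<bar> \<le> M n" if "t \<in> ?I" for n t
  proof -
    have "(C * (t - \<alpha>)) ^ n / fact n \<le> M n"
      unfolding M_def using that \<open>0 \<le> C\<close>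
      by (intro divide_right_mono power_mono mult_left_mono) auto
    with picard_bound[OF cont C that, of n] show "\<bar>f n t\<bar> \<le> M n" "\<bar>g n t\<bar> \<le> M n"
      unfolding f_def g_def by auto
  qed
  have "summable M"
    unfolding M_def using summable_exp[of "C * (\<beta> - \<alpha>)"] by (simp add: field_simps)
  have unif: "uniform_limit ?I (\<lambda>n t. \<Sum>i<n. D i t) (\<lambda>t. \<Sum>i. D i t) sequentially"
    if "\<And>n t. t \<in> ?I \<Longrightarrow> \<bar>D n t\<bar> \<le> C * M n" for D :: "nat \<Rightarrow> real \<Rightarrow> real"
    by (rule Weierstrass_m_test[where M = "\<lambda>n. C * M n"])
      (use that \<open>summable M\<close> in \<open>auto intro: summable_mult\<close>)
  have sums: "summable (\<lambda>n. f n t)" "summable (\<lambda>n. g n t)" if "t \<in> ?I" for t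
    using bound[OF that] by (auto intro: summable_comparison_test'[OF \<open>summable M\<close>])
  have step: "(f (Suc n) has_real_derivative A t * g n t) (at t within ?I)"
    "(g (Suc n) has_real_derivative B t * f n t) (at t within ?I)" if "t \<in> ?I" for n t
    using picard_derivative[OF cont that] unfolding f_def g_def by auto
  have start: "f (Suc n) \<alpha> = 0" "g (Suc n) \<alpha> = 0" for n
    unfolding f_def g_def by auto
  have "\<bar>A t * g n t\<bar> \<le> C * M n" "\<bar>B t * f n t\<bar> \<le> C * M n" if "t \<in> ?I" for n t
    unfolding abs_mult using C[OF that] bound[OF that, of n] \<open>0 \<le> C\<close> by (auto intro!: mult_mono)
  note unif = unif[of "\<lambda>n t. A t * g n t", OF this(1)] unif[of "\<lambda>n t. B t * f n t", OF this(2)]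
  have "\<alpha> \<in> ?I" using \<open>\<alpha> \<le> \<beta>\<close> by simp
  have "summable (\<lambda>n. f (Suc n) \<alpha>)" "summable (\<lambda>n. g (Suc n) \<alpha>)" using start by simp_all
  note init = \<open>\<alpha> \<in> ?I\<close> this
  \<comment> \<open>Termwise differentiation concerns the indices from 1 on, where each term is an
    integral of its predecessor. The derivative series then runs over all indices from 0.\<close>
  obtain X where X: "\<forall>t\<in>?I. (\<lambda>n. f (Suc n) t) sums X t \<and>
      (X has_real_derivative (\<Sum>n. A t * g n t)) (at t within ?I)"
    using has_field_derivative_series[OF _ step(1) unif(1) init(1,2)] by auto
  obtain Y where Y: "\<forall>t\<in>?I. (\<lambda>n. g (Suc n) t) sums Y t \<and>
      (Y has_real_derivative (\<Sum>n. B t * f n t)) (at t within ?I)"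
    using has_field_derivative_series[OF _ step(2) unif(2) init(1,3)] by auto
  \<comment> \<open>The head terms put back here are the constants 1 and 0, which explains the
    asymmetric pair \<open>1 + X\<close>, \<open>Y\<close>.\<close>
  have "(\<Sum>n. f n t) = 1 + X t" "(\<Sum>n. g n t) = Y t" if "t \<in> ?I" for t
    using X Y that suminf_split_head[OF sums(1)[OF that]] suminf_split_head[OF sums(2)[OF that]]
    by (auto simp: sums_iff f_def g_def)
  then have "linear_system A B \<alpha> \<beta> (\<lambda>t. 1 + X t) Y"
    unfolding linear_system_def using X Y sums
    by (auto intro!: derivative_eq_intros simp: suminf_mult)
  moreover have "(\<lambda>_. 0) sums X \<alpha>" "(\<lambda>_. 0) sums Y \<alpha>"
    using X[rule_format, OF \<open>\<alpha> \<in> ?I\<close>] Y[rule_format, OF \<open>\<alpha> \<in> ?I\<close>]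
    unfolding start by blast+
  then have "X \<alpha> = 0" "Y \<alpha> = 0"
    using sums_unique2 sums_zero by blast+
  ultimately show ?thesis by - (rule exI[of _ "\<lambda>t. 1 + X t"], rule exI[of _ Y], simp)
qed

section \<open>Zeros and positivity of solutions\<close>

lemma abs_two_mult_le: "\<bar>2 * a * b\<bar> \<le> a\<^sup>2 + b\<^sup>2" for a b :: real
  using sum_squares_bound[of a b] sum_squares_bound[of a "- b"] by (simp add: abs_le_iff)

text \<open>The derivative of \<open>x^2 + y^2\<close> is \<open>(A + B) * 2 * x * y\<close>, at
  least \<open>- C * (x^2 + y^2)\<close> when \<open>C\<close> bounds \<open>A + B\<close> in
  absolute value. Hence the weight \<open>exp (C * r)\<close> makes it nondecreasing, and a zero at
  \<open>t\<close> propagates to the left.\<close>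

lemma double_zero_imp_trivial:
  assumes sys: "linear_system A B \<alpha> \<beta> x y"
    and cont: "continuous_on {\<alpha>..\<beta>} A" "continuous_on {\<alpha>..\<beta>} B"
    and t: "t \<in> {\<alpha>..\<beta>}" "x t = 0" "y t = 0" and "s \<in> {\<alpha>..t}"
  shows "x s = 0" and "y s = 0"
proof -
  let ?I = "{\<alpha>..\<beta>}"
  have "bounded ((\<lambda>t. A t + B t) ` ?I)"
    using cont by (auto intro!: compact_imp_bounded compact_continuous_image continuous_intros)
  then obtain C where C: "\<And>r. r \<in> ?I \<Longrightarrow> \<bar>A r + B r\<bar> \<le> C"
    unfolding bounded_iff by force
  define E where "E r = exp (C * r) * ((x r)\<^sup>2 + (y r)\<^sup>2)" for r
  have "E s \<le> E t"
  proof (rule nonneg_deriv_le[where f = E and \<alpha> = \<alpha> and \<beta> = \<beta>])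
    fix r assume r: "r \<in> ?I"
    show "(E has_real_derivative exp (C * r) *
        (C * ((x r)\<^sup>2 + (y r)\<^sup>2) + (A r + B r) * (2 * x r * y r))) (at r within ?I)"
      unfolding E_def
      by (auto intro!: derivative_eq_intros linear_systemD[OF sys r] simp: algebra_simps power2_eq_square)
    have "\<bar>(A r + B r) * (2 * x r * y r)\<bar> \<le> C * ((x r)\<^sup>2 + (y r)\<^sup>2)"
      unfolding abs_mult[of "A r + B r"]
    proof (intro mult_mono C r)
      show "\<bar>2 * x r * y r\<bar> \<le> (x r)\<^sup>2 + (y r)\<^sup>2"
        by (rule abs_two_mult_le)
    qed (use C[OF r] in auto)
    then show "0 \<le> exp (C * r) * (C * ((x r)\<^sup>2 + (y r)\<^sup>2) + (A r + B r) * (2 * x r * y r))"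
      by simp
  qed (use assms(4,7) in auto)
  then have "(x s)\<^sup>2 + (y s)\<^sup>2 \<le> 0"
    using t by (simp add: E_def zero_less_mult_iff mult_le_0_iff not_less)
  then show "x s = 0" "y s = 0"
    using sum_power2_le_zero_iff by auto
qed

text \<open>The derivative \<open>A * y^2 + B * x^2\<close> of \<open>x * y\<close> is nonnegative,
  so \<open>x * y\<close> stays nonnegative. Then \<open>x^2\<close>, with derivative
  \<open>2 * A * x * y\<close>, never falls below 1, and \<open>x\<close> cannot cross zero.\<close>

lemma positive_of_nonneg_coefficients:
  assumes sys: "linear_system A B \<alpha> \<beta> x y" and "x \<alpha> = 1" "y \<alpha> = 0"
    and nonneg: "\<And>t. t \<in> {\<alpha>..\<beta>} \<Longrightarrow> 0 \<le> A t" "\<And>t. t \<in> {\<alpha>..\<beta>} \<Longrightarrow> 0 \<le> B t"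
    and t: "t \<in> {\<alpha>..\<beta>}"
  shows "0 < x t"
proof -
  let ?I = "{\<alpha>..\<beta>}"
  have xy: "0 \<le> x r * y r" if r: "r \<in> ?I" for r
  proof -
    have "x \<alpha> * y \<alpha> \<le> x r * y r"
      by (rule nonneg_deriv_le[where \<alpha> = \<alpha> and \<beta> = \<beta> and f' = "\<lambda>s. A s * (y s)\<^sup>2 + B s * (x s)\<^sup>2"])
        (use r nonneg in \<open>auto intro!: derivative_eq_intros linear_systemD[OF sys] simp: power2_eq_square\<close>)
    then show ?thesis using assms(3) by simp
  qed
  have sq: "1 \<le> (x r)\<^sup>2" if r: "r \<in> ?I" for r
  proof -
    have "(x \<alpha>)\<^sup>2 \<le> (x r)\<^sup>2"
      by (rule nonneg_deriv_le[where \<alpha> = \<alpha> and \<beta> = \<beta> and f' = "\<lambda>s. 2 * A s * (x s * y s)"])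
        (use r nonneg xy in \<open>auto intro!: derivative_eq_intros linear_systemD[OF sys]\<close>)
    then show ?thesis using assms(2) by simp
  qed
  show ?thesis
  proof (rule ccontr)
    assume "\<not> 0 < x t"
    then obtain s where "s \<in> {\<alpha>..t}" "x s = 0"
      using IVT2'[of x t 0 \<alpha>] continuous_on_subset[OF linear_system_continuous(1)[OF sys], of "{\<alpha>..t}"]
        t assms(2) by auto
    then show False using sq[of s] t by auto
  qed
qed

text \<open>The angle \<open>arctan (y / (s x))\<close> has range of length less than \<open>\<pi>\<close> as long as
  \<open>x\<close> is positive, but it decreases with speed at least \<open>\<kappa> s\<close>.\<close>

lemma oscillation:
  assumes sys: "linear_system A B \<alpha> \<beta> x y"
    and sub: "\<alpha> \<le> \<gamma>" "\<gamma> \<le> \<delta>" "\<delta> \<le> \<beta>" and "0 < s" "pi \<le> s * \<kappa> * (\<delta> - \<gamma>)"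
    and A: "\<And>t. t \<in> {\<gamma>..\<delta>} \<Longrightarrow> \<kappa> \<le> A t" and B: "\<And>t. t \<in> {\<gamma>..\<delta>} \<Longrightarrow> B t \<le> - (\<kappa> * s\<^sup>2)"
  shows "\<exists>t\<in>{\<gamma>..\<delta>}. x t \<le> 0"
proof (rule ccontr)
  assume "\<not> ?thesis"
  then have pos: "0 < x t" if "t \<in> {\<gamma>..\<delta>}" for t
    using that by force
  define \<theta> where "\<theta> t = arctan (y t / (s * x t))" for t
  have "- \<theta> \<gamma> - s * \<kappa> * \<gamma> \<le> - \<theta> \<delta> - s * \<kappa> * \<delta>"
  proof (rule nonneg_deriv_le[where f = "\<lambda>t. - \<theta> t - s * \<kappa> * t" and \<alpha> = \<gamma> and \<beta> = \<delta>])
    fix t assume t: "t \<in> {\<gamma>..\<delta>}"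
    let ?N = "s\<^sup>2 * (x t)\<^sup>2 + (y t)\<^sup>2"
    have N: "0 < ?N" using pos[OF t] \<open>0 < s\<close> by (simp add: add_pos_nonneg)
    have der: "(x has_real_derivative A t * y t) (at t within {\<gamma>..\<delta>})"
      "(y has_real_derivative B t * x t) (at t within {\<gamma>..\<delta>})"
      using linear_systemD[OF sys, of t] t sub
      by (auto elim!: DERIV_subset)
    have "(\<theta> has_real_derivative inverse (1 + (y t / (s * x t))\<^sup>2) *
        ((B t * x t * (s * x t) - y t * (s * (A t * y t))) / ((s * x t) * (s * x t))))
        (at t within {\<gamma>..\<delta>})"
      unfolding \<theta>_def using pos[OF t] \<open>0 < s\<close>
      by (auto intro!: derivative_eq_intros der)
    moreover have "inverse (1 + (y t / (s * x t))\<^sup>2) *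
        ((B t * x t * (s * x t) - y t * (s * (A t * y t))) / ((s * x t) * (s * x t)))
        = s * (B t * (x t)\<^sup>2 - A t * (y t)\<^sup>2) / ?N"
    proof -
      have "s * x t \<noteq> 0" using pos[OF t] \<open>0 < s\<close> by simp
      then have "1 + (y t / (s * x t))\<^sup>2 = ?N / ((s * x t) * (s * x t))"
        by (simp add: power_divide power_mult_distrib add_divide_distrib flip: power2_eq_square)
      moreover have "B t * x t * (s * x t) - y t * (s * (A t * y t)) =
          s * (B t * (x t)\<^sup>2 - A t * (y t)\<^sup>2)"
        by (simp add: algebra_simps power2_eq_square)
      ultimately show ?thesis
        using \<open>s * x t \<noteq> 0\<close> N by simp
    qed
    ultimately have "(\<theta> has_real_derivative s * (B t * (x t)\<^sup>2 - A t * (y t)\<^sup>2) / ?N)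
        (at t within {\<gamma>..\<delta>})" by simp
    then show "((\<lambda>t. - \<theta> t - s * \<kappa> * t) has_real_derivative
        - (s * (B t * (x t)\<^sup>2 - A t * (y t)\<^sup>2) / ?N) - s * \<kappa>) (at t within {\<gamma>..\<delta>})"
      by (auto intro!: derivative_eq_intros)
    \<comment> \<open>The factor \<open>s\<close> in the angle is chosen so that both bounds
      contribute the same multiple \<open>- \<kappa>\<close> to the two summands of
      \<open>?N\<close>.\<close>
    have "B t * (x t)\<^sup>2 \<le> - (\<kappa> * s\<^sup>2) * (x t)\<^sup>2" "\<kappa> * (y t)\<^sup>2 \<le> A t * (y t)\<^sup>2"
      using A[OF t] B[OF t] by (intro mult_right_mono; simp)+
    then have "B t * (x t)\<^sup>2 - A t * (y t)\<^sup>2 \<le> - \<kappa> * ?N"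
      by (simp add: algebra_simps)
    then have "s * (B t * (x t)\<^sup>2 - A t * (y t)\<^sup>2) \<le> s * (- \<kappa> * ?N)"
      using \<open>0 < s\<close> by (intro mult_left_mono) auto
    then have "s * (B t * (x t)\<^sup>2 - A t * (y t)\<^sup>2) / ?N \<le> - (s * \<kappa>)"
      using N by (simp add: pos_divide_le_eq mult.assoc)
    then show "0 \<le> - (s * (B t * (x t)\<^sup>2 - A t * (y t)\<^sup>2) / ?N) - s * \<kappa>" by simp
  qed (use sub in auto)
  \<comment> \<open>The angle would have to drop by at least \<open>pi\<close>, yet its values lie
    in an open interval of that length.\<close>
  moreover have "\<theta> \<gamma> < pi / 2" "- (pi / 2) < \<theta> \<delta>"
    unfolding \<theta>_def by (rule arctan_ubound, rule arctan_lbound)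
  ultimately show False using assms(6) by (simp add: algebra_simps)
qed

section \<open>Dependence of the solution on the parameter\<close>

text \<open>A Gronwall argument for the squared distance \<open>E\<close> of the two solutions:
  \<open>E'\<close> is at most \<open>(C + 1) * (E + \<eta>\<^sup>2)\<close>, and \<open>E\<close>
  starts at 0.\<close>

lemma linear_system_perturbation:
  assumes sys: "linear_system A B \<alpha> \<beta> x y" "linear_system A B' \<alpha> \<beta> x' y'"
    and init: "x' \<alpha> = x \<alpha>" "y' \<alpha> = y \<alpha>"
    and C: "\<And>t. t \<in> {\<alpha>..\<beta>} \<Longrightarrow> \<bar>A t + B' t\<bar> \<le> C"
    and \<eta>: "\<And>t. t \<in> {\<alpha>..\<beta>} \<Longrightarrow> \<bar>(B' t - B t) * x t\<bar> \<le> \<eta>"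
    and t: "t \<in> {\<alpha>..\<beta>}"
  shows "\<bar>x' t - x t\<bar> \<le> \<eta> * exp ((C + 1) * (\<beta> - \<alpha>))"
proof -
  have nonneg: "0 \<le> C" "0 \<le> \<eta>" using C[OF t] \<eta>[OF t] by auto
  define E where "E r = (x' r - x r)\<^sup>2 + (y' r - y r)\<^sup>2" for r
  define E' where "E' r = (A r + B' r) * (2 * (x' r - x r) * (y' r - y r))
    + 2 * (y' r - y r) * ((B' r - B r) * x r)" for r
  define F where "F r = - (exp (- ((C + 1) * (r - \<alpha>))) * (E r + \<eta>\<^sup>2))" for r
  have "F \<alpha> \<le> F t"
  proof (rule nonneg_deriv_le[where f = F and \<alpha> = \<alpha> and \<beta> = \<beta>])
    fix r assume r: "r \<in> {\<alpha>..\<beta>}"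
    have "(E has_real_derivative E' r) (at r within {\<alpha>..\<beta>})"
      unfolding E_def E'_def
      by (auto intro!: derivative_eq_intros linear_systemD[OF sys(1) r] linear_systemD[OF sys(2) r]
          simp: algebra_simps)
    then show "(F has_real_derivative
        exp (- ((C + 1) * (r - \<alpha>))) * ((C + 1) * (E r + \<eta>\<^sup>2) - E' r)) (at r within {\<alpha>..\<beta>})"
      unfolding F_def by (auto intro!: derivative_eq_intros simp: algebra_simps)
    have "(A r + B' r) * (2 * (x' r - x r) * (y' r - y r)) \<le> C * E r"
    proof -
      have "(A r + B' r) * (2 * (x' r - x r) * (y' r - y r))
          \<le> \<bar>A r + B' r\<bar> * \<bar>2 * (x' r - x r) * (y' r - y r)\<bar>"
        by (metis abs_ge_self abs_mult)
      also have "\<dots> \<le> C * E r"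
      proof (intro mult_mono C r)
        show "\<bar>2 * (x' r - x r) * (y' r - y r)\<bar> \<le> E r"
          unfolding E_def by (rule abs_two_mult_le)
      qed (use nonneg in auto)
      finally show ?thesis .
    qed
    moreover have "2 * (y' r - y r) * ((B' r - B r) * x r) \<le> E r + \<eta>\<^sup>2"
    proof -
      have "((B' r - B r) * x r)\<^sup>2 \<le> \<eta>\<^sup>2"
        using \<eta>[OF r] by (metis abs_ge_zero power2_abs power_mono)
      then show ?thesis
        using sum_squares_bound[of "y' r - y r" "(B' r - B r) * x r"] zero_le_power2[of "x' r - x r"]
        unfolding E_def by linarith
    qed
    moreover have "0 \<le> C * \<eta>\<^sup>2" using nonneg by simp
    ultimately have "E' r \<le> (C + 1) * (E r + \<eta>\<^sup>2)"
      unfolding E'_def distrib_left distrib_right by linarith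
    then show "0 \<le> exp (- ((C + 1) * (r - \<alpha>))) * ((C + 1) * (E r + \<eta>\<^sup>2) - E' r)"
      by simp
  qed (use t in auto)
  then have "exp (- ((C + 1) * (t - \<alpha>))) * (E t + \<eta>\<^sup>2) \<le> \<eta>\<^sup>2"
    by (simp add: F_def E_def init)
  then have "E t + \<eta>\<^sup>2 \<le> \<eta>\<^sup>2 * exp ((C + 1) * (t - \<alpha>))"
    by (simp only: exp_minus divide_inverse_commute[symmetric] pos_divide_le_eq exp_gt_zero)
  \<comment> \<open>Doubling the exponent turns the bound into a perfect square, so that the root
    can be taken directly.\<close>
  also have "\<dots> \<le> \<eta>\<^sup>2 * (exp ((C + 1) * (\<beta> - \<alpha>)))\<^sup>2"
  proof -
    have "exp ((C + 1) * (t - \<alpha>)) \<le> exp (2 * ((C + 1) * (\<beta> - \<alpha>)))"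
    proof -
      have "(C + 1) * (t - \<alpha>) \<le> (C + 1) * (\<beta> - \<alpha>)" "0 \<le> (C + 1) * (\<beta> - \<alpha>)"
        using t nonneg by (auto intro!: mult_left_mono mult_nonneg_nonneg)
      then have "(C + 1) * (t - \<alpha>) \<le> 2 * ((C + 1) * (\<beta> - \<alpha>))" by linarith
      then show ?thesis by simp
    qed
    then show ?thesis by (intro mult_left_mono) (auto simp: exp_double)
  qed
  finally have "(x' t - x t)\<^sup>2 \<le> (\<eta> * exp ((C + 1) * (\<beta> - \<alpha>)))\<^sup>2"
    unfolding E_def power_mult_distrib
    using zero_le_power2[of "y' t - y t"] zero_le_power2[of \<eta>] by linarith
  then show ?thesis
    using nonneg abs_le_square_iff[of "x' t - x t" "\<eta> * exp ((C + 1) * (\<beta> - \<alpha>))"] by simp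
qed

lemma continuous_on_interval_bound:
  fixes f :: "real \<Rightarrow> real"
  assumes "continuous_on {\<alpha>..\<beta>} f"
  obtains C where "0 < C" "\<And>t. t \<in> {\<alpha>..\<beta>} \<Longrightarrow> \<bar>f t\<bar> \<le> C"
proof -
  have "bounded (f ` {\<alpha>..\<beta>})"
    using assms by (auto intro!: compact_imp_bounded compact_continuous_image)
  then show thesis unfolding bounded_pos using that by auto
qed

lemma continuous_dependence:
  assumes sys: "\<And>a. linear_system A (\<lambda>t. q t - a * M t) \<alpha> \<beta> (x a) (y a)"
    and init: "\<And>a. x a \<alpha> = 1" "\<And>a. y a \<alpha> = 0"
    and cont: "continuous_on {\<alpha>..\<beta>} A" "continuous_on {\<alpha>..\<beta>} q" "continuous_on {\<alpha>..\<beta>} M"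
    and "0 < e"
  obtains d where "0 < d" "\<And>a t. \<bar>a - b\<bar> < d \<Longrightarrow> t \<in> {\<alpha>..\<beta>} \<Longrightarrow> \<bar>x a t - x b t\<bar> < e"
proof -
  let ?I = "{\<alpha>..\<beta>}"
  obtain K where K: "0 < K" "\<And>t. t \<in> ?I \<Longrightarrow> \<bar>A t + q t\<bar> \<le> K"
    using continuous_on_interval_bound[OF continuous_on_add[OF cont(1,2)]] by blast
  obtain S where S: "0 < S" "\<And>t. t \<in> ?I \<Longrightarrow> \<bar>M t\<bar> \<le> S"
    using continuous_on_interval_bound[OF cont(3)] by blast
  obtain X where X: "0 < X" "\<And>t. t \<in> ?I \<Longrightarrow> \<bar>M t * x b t\<bar> \<le> X"
    using continuous_on_interval_bound[OF continuous_on_mult[OF cont(3)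
          linear_system_continuous(1)[OF sys[of b]]]] by blast
  \<comment> \<open>Only parameters at distance less than 1 from \<open>b\<close> are considered, so
    this bound on \<open>A + (q - a * M)\<close> does not depend on \<open>a\<close>.\<close>
  define C where "C = K + (\<bar>b\<bar> + 1) * S"
  define G where "G = X * exp ((C + 1) * (\<beta> - \<alpha>))"
  have "0 < G" unfolding G_def using X(1) by simp
  show thesis
  proof (rule that[of "min 1 (e / G)"])
    show "0 < min 1 (e / G)" using \<open>0 < e\<close> \<open>0 < G\<close> by simp
    fix a t assume a: "\<bar>a - b\<bar> < min 1 (e / G)" and t: "t \<in> ?I"
    have "\<bar>x a t - x b t\<bar> \<le> \<bar>a - b\<bar> * X * exp ((C + 1) * (\<beta> - \<alpha>))"
    proof (rule linear_system_perturbation[OF sys sys])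
      fix r assume r: "r \<in> ?I"
      have "\<bar>a * M r\<bar> \<le> (\<bar>b\<bar> + 1) * S"
        unfolding abs_mult using a S(2)[OF r] by (intro mult_mono) auto
      then show "\<bar>A r + (q r - a * M r)\<bar> \<le> C"
        unfolding C_def using K(2)[OF r] by linarith
      have "(q r - a * M r - (q r - b * M r)) * x b r = - ((a - b) * (M r * x b r))"
        by (simp add: algebra_simps)
      then show "\<bar>(q r - a * M r - (q r - b * M r)) * x b r\<bar> \<le> \<bar>a - b\<bar> * X"
        using X(2)[OF r] by (simp add: abs_mult mult_left_mono)
    qed (use init t in auto)
    also have "\<dots> = \<bar>a - b\<bar> * G" by (simp add: G_def)
    also have "\<dots> < e" using a \<open>0 < G\<close> by (simp add: pos_less_divide_eq)
    finally show "\<bar>x a t - x b t\<bar> < e" .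
  qed
qed

text \<open>Near \<tau> the weight stays above a positive constant, so a large parameter makes the
  coefficient negative enough there for \<open>oscillation\<close>.\<close>

lemma nonpositive_for_some_parameter:
  assumes "\<alpha> < \<beta>"
    and sys: "\<And>a. linear_system A (\<lambda>t. q t - a * M t) \<alpha> \<beta> (x a) (y a)"
    and cont: "continuous_on {\<alpha>..\<beta>} A" "continuous_on {\<alpha>..\<beta>} q" "continuous_on {\<alpha>..\<beta>} M"
    and A: "\<And>t. t \<in> {\<alpha>..\<beta>} \<Longrightarrow> 0 < A t"
    and \<tau>: "\<tau> \<in> {\<alpha>..\<beta>}" "0 < M \<tau>"
  shows "\<exists>a\<ge>0. \<exists>t\<in>{\<alpha>..\<beta>}. x a t \<le> 0"
proof -
  let ?I = "{\<alpha>..\<beta>}"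
  define \<mu> where "\<mu> = M \<tau> / 2"
  have "0 < \<mu>" using \<tau> by (simp add: \<mu>_def)
  obtain d where d: "0 < d" "\<And>t. t \<in> ?I \<Longrightarrow> \<bar>t - \<tau>\<bar> < d \<Longrightarrow> \<bar>M t - M \<tau>\<bar> < \<mu>"
    using cont(3) \<tau>(1) \<open>0 < \<mu>\<close> unfolding continuous_on_iff dist_real_def by meson
  define \<gamma> \<delta> where "\<gamma> = max \<alpha> (\<tau> - d / 2)" and "\<delta> = min \<beta> (\<tau> + d / 2)"
  have sub: "\<alpha> \<le> \<gamma>" "\<gamma> < \<delta>" "\<delta> \<le> \<beta>" using \<open>\<alpha> < \<beta>\<close> d(1) \<tau>(1) by (auto simp: \<gamma>_def \<delta>_def)
  have M: "\<mu> \<le> M t" if "t \<in> {\<gamma>..\<delta>}" for t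
  proof -
    have "t \<in> ?I" "\<bar>t - \<tau>\<bar> < d"
      using that sub d(1) by (auto simp: \<gamma>_def \<delta>_def abs_less_iff)
    then show ?thesis using d(2)[of t] unfolding \<mu>_def by linarith
  qed
  obtain \<kappa> where \<kappa>: "0 < \<kappa>" "\<And>t. t \<in> ?I \<Longrightarrow> \<kappa> \<le> A t"
    using continuous_attains_inf[of ?I A] cont(1) A \<tau>(1) by (metis compact_Icc empty_iff)
  obtain Q where Q: "0 < Q" "\<And>t. t \<in> ?I \<Longrightarrow> \<bar>q t\<bar> \<le> Q"
    using continuous_on_interval_bound[OF cont(2)] by blast
  \<comment> \<open>With this \<open>s\<close> the angle drops by exactly the required
    \<open>pi\<close>, and \<open>a\<close> is such that \<open>Q - a * \<mu>\<close> equals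
    \<open>- (\<kappa> * s\<^sup>2)\<close>.\<close>
  define s where "s = pi / (\<kappa> * (\<delta> - \<gamma>))"
  define a where "a = (Q + \<kappa> * s\<^sup>2) / \<mu>"
  have "0 \<le> a" unfolding a_def using Q(1) \<kappa>(1) \<open>0 < \<mu>\<close> by simp
  have "\<exists>t\<in>{\<gamma>..\<delta>}. x a t \<le> 0"
  proof (rule oscillation[OF sys])
    show "0 < s" unfolding s_def using \<kappa>(1) sub by simp
    show "pi \<le> s * \<kappa> * (\<delta> - \<gamma>)" unfolding s_def using \<kappa>(1) sub by simp
    fix t assume t: "t \<in> {\<gamma>..\<delta>}"
    have "a * \<mu> \<le> a * M t" using M[OF t] \<open>0 \<le> a\<close> by (rule mult_left_mono)
    moreover have "a * \<mu> = Q + \<kappa> * s\<^sup>2" using \<open>0 < \<mu>\<close> by (simp add: a_def)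
    moreover have "q t \<le> Q" using Q(2)[of t] t sub by auto
    ultimately show "q t - a * M t \<le> - (\<kappa> * s\<^sup>2)" by linarith
  qed (use sub \<kappa>(2) in auto)
  then show ?thesis using \<open>0 \<le> a\<close> sub by (intro exI[of _ a]) auto
qed

section \<open>Principal eigenfunctions\<close>

text \<open>The parameter sought is the least one at which the shooting solution loses positivity.
  The strict sign of \<open>y \<beta>\<close> serves later for matching derivatives at the common
  zero.\<close>

theorem principal_eigenfunction_right_Dirichlet:
  assumes "\<alpha> < \<beta>"
    and cont: "continuous_on {\<alpha>..\<beta>} A" "continuous_on {\<alpha>..\<beta>} q" "continuous_on {\<alpha>..\<beta>} M"
    and A: "\<And>t. t \<in> {\<alpha>..\<beta>} \<Longrightarrow> 0 < A t" and q: "\<And>t. t \<in> {\<alpha>..\<beta>} \<Longrightarrow> 0 \<le> q t"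
    and \<tau>: "\<tau> \<in> {\<alpha>..\<beta>}" "0 < M \<tau>"
  shows "\<exists>a\<ge>0. \<exists>x y. linear_system A (\<lambda>t. q t - a * M t) \<alpha> \<beta> x y \<and>
    y \<alpha> = 0 \<and> (\<forall>t\<in>{\<alpha>..<\<beta>}. 0 < x t) \<and> x \<beta> = 0 \<and> y \<beta> < 0"
proof -
  let ?I = "{\<alpha>..\<beta>}"
  have B: "continuous_on ?I (\<lambda>t. q t - a * M t)" for a
    using cont by (intro continuous_intros)
  have "\<forall>a. \<exists>x y. linear_system A (\<lambda>t. q t - a * M t) \<alpha> \<beta> x y \<and> x \<alpha> = 1 \<and> y \<alpha> = 0"
    using linear_system_exists[OF _ cont(1) B] \<open>\<alpha> < \<beta>\<close> by simp
  then obtain x y where sys: "\<And>a. linear_system A (\<lambda>t. q t - a * M t) \<alpha> \<beta> (x a) (y a)"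
    and init: "\<And>a. x a \<alpha> = 1" "\<And>a. y a \<alpha> = 0" by metis
  define Z where "Z = {a. 0 \<le> a \<and> (\<exists>t\<in>?I. x a t \<le> 0)}"
  define b where "b = Inf Z"
  have "Z \<noteq> {}"
    using nonpositive_for_some_parameter[OF \<open>\<alpha> < \<beta>\<close> sys cont A \<tau>] unfolding Z_def by auto
  have bdd: "bdd_below Z" unfolding Z_def by (auto intro: bdd_belowI[of _ 0])
  have "0 \<le> b" unfolding b_def using \<open>Z \<noteq> {}\<close> by (rule cInf_greatest) (simp add: Z_def)
  have below: "0 < x a t" if "0 \<le> a" "a < b" "t \<in> ?I" for a t
    using that cInf_lower[OF _ bdd, of a] unfolding b_def Z_def by force
  \<comment> \<open>The infimum is attained: a positive \<open>x b\<close> is bounded below by some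
    \<open>e > 0\<close>, and continuous dependence would keep all parameters below
    \<open>b + d\<close> out of \<open>Z\<close>.\<close>
  have zero: "\<exists>t\<in>?I. x b t \<le> 0"
  proof (rule ccontr)
    assume "\<not> ?thesis"
    then have pos: "\<And>t. t \<in> ?I \<Longrightarrow> 0 < x b t" by force
    have "?I \<noteq> {}" using \<open>\<alpha> < \<beta>\<close> by simp
    then obtain e where e: "0 < e" "\<And>t. t \<in> ?I \<Longrightarrow> e \<le> x b t"
      using continuous_attains_inf[of ?I "x b"] linear_system_continuous(1)[OF sys] pos
      by (metis compact_Icc)
    obtain d where d: "0 < d" "\<And>a t. \<bar>a - b\<bar> < d \<Longrightarrow> t \<in> ?I \<Longrightarrow> \<bar>x a t - x b t\<bar> < e"
      using continuous_dependence[OF sys init cont e(1)] by blast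
    have "b + d \<le> a" if "a \<in> Z" for a
    proof (rule ccontr)
      assume "\<not> b + d \<le> a"
      moreover have "b \<le> a" unfolding b_def using that bdd by (rule cInf_lower)
      ultimately have "0 < x a t" if "t \<in> ?I" for t
        using d(2)[of a t] e(2)[of t] that by (simp add: abs_if split: if_splits)
      with \<open>a \<in> Z\<close> show False unfolding Z_def by force
    qed
    then have "b + d \<le> b" unfolding b_def using \<open>Z \<noteq> {}\<close> cInf_greatest by blast
    with d(1) show False by simp
  qed
  \<comment> \<open>At parameter 0 the coefficients are nonnegative and the solution is positive.
    The strict inequality leaves room for admissible parameters just below \<open>b\<close>.\<close>
  have "0 < b"
  proof (rule ccontr)
    assume "\<not> 0 < b"
    then have "b = 0" using \<open>0 \<le> b\<close> by simp
    then have "0 < x b t" if "t \<in> ?I" for t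
      using positive_of_nonneg_coefficients[OF sys[of 0] init(1) init(2)] A q that by (simp add: less_imp_le)
    with zero show False by force
  qed
  \<comment> \<open>A negative value would persist for parameters slightly below \<open>b\<close>,
    whose solutions are positive.\<close>
  have nonneg: "0 \<le> x b t" if t: "t \<in> ?I" for t
  proof (rule ccontr)
    assume "\<not> 0 \<le> x b t"
    then have "0 < - x b t" by simp
    then obtain d where d: "0 < d" "\<And>a r. \<bar>a - b\<bar> < d \<Longrightarrow> r \<in> ?I \<Longrightarrow> \<bar>x a r - x b r\<bar> < - x b t"
      using continuous_dependence[OF sys init cont] by blast
    have "0 < x (max 0 (b - d / 2)) t"
      using below[of "max 0 (b - d / 2)" t] d(1) t \<open>0 < b\<close> by auto
    moreover have "\<bar>max 0 (b - d / 2) - b\<bar> < d" using d(1) \<open>0 < b\<close> by (auto simp: max_def)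
    ultimately show False using d(2)[of "max 0 (b - d / 2)" t] t by linarith
  qed
  \<comment> \<open>A double zero would propagate back to \<alpha>, where the solution is 1.\<close>
  have no_double: "y b t \<noteq> 0" if t: "t \<in> ?I" "x b t = 0" for t
    using double_zero_imp_trivial(1)[OF sys cont(1) B t, of \<alpha>] t init(1)[of b] by auto
  \<comment> \<open>An interior zero is a minimum of the nonnegative \<open>x b\<close>, so
    \<open>A * y b\<close> vanishes there too and the zero is double.\<close>
  have interior: "x b t \<noteq> 0" if t: "t \<in> {\<alpha>..<\<beta>}" for t
  proof
    assume "x b t = 0"
    with init(1)[of b] t have t': "t \<in> {\<alpha><..<\<beta>}" by (cases "t = \<alpha>") auto
    then have "DERIV (x b) t :> A t * y b t"
      using linear_systemD(1)[OF sys[of b], of t] at_within_interior[of t ?I] by auto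
    moreover have "\<exists>d>0. \<forall>r. \<bar>t - r\<bar> < d \<longrightarrow> x b t \<le> x b r"
      using t' nonneg \<open>x b t = 0\<close>
      by (intro exI[of _ "min (t - \<alpha>) (\<beta> - t)"]) (auto simp: abs_if split: if_splits)
    ultimately have "A t * y b t = 0" using DERIV_local_min by blast
    then show False using no_double[of t] A[of t] t \<open>x b t = 0\<close> by auto
  qed
  have "x b \<beta> = 0"
    using zero nonneg interior by (metis antisym atLeastAtMost_iff atLeastLessThan_iff less_eq_real_def)
  \<comment> \<open>A positive slope at the zero \<beta> would make \<open>x b\<close> negative just
    to its left.\<close>
  moreover have "y b \<beta> < 0"
  proof (rule ccontr)
    assume "\<not> y b \<beta> < 0"
    then have "0 < A \<beta> * y b \<beta>"
      using no_double[of \<beta>] \<open>x b \<beta> = 0\<close> A[of \<beta>] \<open>\<alpha> < \<beta>\<close> by auto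
    then obtain d where d: "0 < d" "\<And>h. 0 < h \<Longrightarrow> \<beta> - h \<in> ?I \<Longrightarrow> h < d \<Longrightarrow> x b (\<beta> - h) < x b \<beta>"
      using has_real_derivative_pos_inc_left[OF linear_systemD(1)[OF sys[of b]], of \<beta>] \<open>\<alpha> < \<beta>\<close> by auto
    define h where "h = min (d / 2) (\<beta> - \<alpha>)"
    have "0 < h" "\<beta> - h \<in> ?I" "h < d" using d(1) \<open>\<alpha> < \<beta>\<close> by (auto simp: h_def)
    then show False using d(2)[of h] nonneg[of "\<beta> - h"] \<open>x b \<beta> = 0\<close> by simp
  qed
  moreover have "\<forall>t\<in>{\<alpha>..<\<beta>}. 0 < x b t"
    using nonneg interior by (metis atLeastAtMost_iff atLeastLessThan_iff less_eq_real_def)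
  ultimately show ?thesis using \<open>0 \<le> b\<close> sys[of b] init(2)[of b] by blast
qed

text \<open>Reflection reverses the sign of both derivatives; negating \<open>y\<close> absorbs this
  in both equations.\<close>

lemma linear_system_reflect:
  assumes "linear_system A B \<alpha> \<beta> x y"
  shows "linear_system (\<lambda>t. A (\<alpha> + \<beta> - t)) (\<lambda>t. B (\<alpha> + \<beta> - t)) \<alpha> \<beta>
    (\<lambda>t. x (\<alpha> + \<beta> - t)) (\<lambda>t. - y (\<alpha> + \<beta> - t))"
  unfolding linear_system_def
proof (intro ballI conjI)
  fix t assume t: "t \<in> {\<alpha>..\<beta>}"
  have img: "(\<lambda>t. \<alpha> + \<beta> - t) ` {\<alpha>..\<beta>} = {\<alpha>..\<beta>}" by simp
  have lin: "((\<lambda>t. \<alpha> + \<beta> - t) has_real_derivative -1) (at t within {\<alpha>..\<beta>})"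
    by (auto intro!: derivative_eq_intros)
  have "\<alpha> + \<beta> - t \<in> {\<alpha>..\<beta>}" using t by auto
  note der = linear_systemD[OF assms this]
  show "((\<lambda>t. x (\<alpha> + \<beta> - t)) has_real_derivative A (\<alpha> + \<beta> - t) * - y (\<alpha> + \<beta> - t)) (at t within {\<alpha>..\<beta>})"
    using DERIV_image_chain[OF _ lin, unfolded img, OF der(1)] by (simp add: o_def)
  show "((\<lambda>t. - y (\<alpha> + \<beta> - t)) has_real_derivative B (\<alpha> + \<beta> - t) * x (\<alpha> + \<beta> - t)) (at t within {\<alpha>..\<beta>})"
    using DERIV_minus[OF DERIV_image_chain[OF _ lin, unfolded img, OF der(2)]] by (simp add: o_def)
qed

theorem principal_eigenfunction_left_Dirichlet:
  assumes "\<alpha> < \<beta>"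
    and cont: "continuous_on {\<alpha>..\<beta>} A" "continuous_on {\<alpha>..\<beta>} q" "continuous_on {\<alpha>..\<beta>} M"
    and A: "\<And>t. t \<in> {\<alpha>..\<beta>} \<Longrightarrow> 0 < A t" and q: "\<And>t. t \<in> {\<alpha>..\<beta>} \<Longrightarrow> 0 \<le> q t"
    and \<tau>: "\<tau> \<in> {\<alpha>..\<beta>}" "0 < M \<tau>"
  shows "\<exists>a\<ge>0. \<exists>x y. linear_system A (\<lambda>t. q t - a * M t) \<alpha> \<beta> x y \<and>
    y \<beta> = 0 \<and> (\<forall>t\<in>{\<alpha><..\<beta>}. 0 < x t) \<and> x \<alpha> = 0 \<and> 0 < y \<alpha>"
proof -
  let ?\<rho> = "\<lambda>t. \<alpha> + \<beta> - t"
  have cont': "continuous_on {\<alpha>..\<beta>} (\<lambda>t. f (?\<rho> t))" if "continuous_on {\<alpha>..\<beta>} f" for f :: "real \<Rightarrow> real"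
    by (rule continuous_on_compose2[OF that]) (auto intro!: continuous_intros)
  have "\<exists>a\<ge>0. \<exists>x y. linear_system (\<lambda>t. A (?\<rho> t)) (\<lambda>t. q (?\<rho> t) - a * M (?\<rho> t)) \<alpha> \<beta> x y \<and>
    y \<alpha> = 0 \<and> (\<forall>t\<in>{\<alpha>..<\<beta>}. 0 < x t) \<and> x \<beta> = 0 \<and> y \<beta> < 0"
    by (rule principal_eigenfunction_right_Dirichlet[where \<tau> = "?\<rho> \<tau>"])
      (use \<open>\<alpha> < \<beta>\<close> cont cont' A q \<tau> in auto)
  then obtain a x y where "0 \<le> a"
    and sys: "linear_system (\<lambda>t. A (?\<rho> t)) (\<lambda>t. q (?\<rho> t) - a * M (?\<rho> t)) \<alpha> \<beta> x y"
    and xy: "y \<alpha> = 0" "\<forall>t\<in>{\<alpha>..<\<beta>}. 0 < x t" "x \<beta> = 0" "y \<beta> < 0" by blast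
  have "linear_system A (\<lambda>t. q t - a * M t) \<alpha> \<beta> (\<lambda>t. x (?\<rho> t)) (\<lambda>t. - y (?\<rho> t))"
    using linear_system_reflect[OF sys] by simp
  then show ?thesis using \<open>0 \<le> a\<close> xy
    by - (rule exI[of _ a], rule conjI, assumption, rule exI[of _ "\<lambda>t. x (?\<rho> t)"],
        rule exI[of _ "\<lambda>t. - y (?\<rho> t)"], auto)
qed

section \<open>Gluing at the common zero\<close>

lemma linear_system_scale:
  assumes "linear_system A B \<alpha> \<beta> x y"
  shows "linear_system A B \<alpha> \<beta> (\<lambda>t. k * x t) (\<lambda>t. k * y t)"
  using linear_systemD[OF assms] unfolding linear_system_def
  by (auto intro!: derivative_eq_intros)

text \<open>The two closed pieces meet only in \<open>c\<close>, so agreement of values and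
  derivatives there suffices for the piecewise rule.\<close>

lemma has_real_derivative_glue:
  fixes f g f' g' :: "real \<Rightarrow> real"
  assumes "t \<in> {\<alpha>..\<beta>}" "\<alpha> \<le> c" "c \<le> \<beta>"
    and f: "\<And>t. t \<in> {\<alpha>..c} \<Longrightarrow> (f has_real_derivative f' t) (at t within {\<alpha>..c})"
    and g: "\<And>t. t \<in> {c..\<beta>} \<Longrightarrow> (g has_real_derivative g' t) (at t within {c..\<beta>})"
    and "f c = g c" "f' c = g' c"
  shows "((\<lambda>t. if t \<in> {\<alpha>..c} then f t else g t) has_real_derivative
    (if t \<in> {\<alpha>..c} then f' t else g' t)) (at t within {\<alpha>..\<beta>})"
proof -
  have sets: "{\<alpha>..c} \<union> closure {\<alpha>..c} \<inter> closure {c..\<beta>} = {\<alpha>..c}"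
    "{c..\<beta>} \<union> closure {\<alpha>..c} \<inter> closure {c..\<beta>} = {c..\<beta>}"
    using assms(2,3) by auto
  show ?thesis
    unfolding has_real_derivative_iff_has_vector_derivative
  proof (rule has_vector_derivative_If_within_closures)
    show "t \<in> {\<alpha>..c} \<union> {c..\<beta>}" "{\<alpha>..\<beta>} = {\<alpha>..c} \<union> {c..\<beta>}" using assms(1-3) by auto
  next
    assume "t \<in> {\<alpha>..c} \<union> closure {\<alpha>..c} \<inter> closure {c..\<beta>}"
    then show "(f has_vector_derivative f' t) (at t within {\<alpha>..c} \<union> closure {\<alpha>..c} \<inter> closure {c..\<beta>})"
      using f[of t] unfolding sets by (simp add: has_real_derivative_iff_has_vector_derivative)
  next
    assume "t \<in> {c..\<beta>} \<union> closure {\<alpha>..c} \<inter> closure {c..\<beta>}"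
    then show "(g has_vector_derivative g' t) (at t within {c..\<beta>} \<union> closure {\<alpha>..c} \<inter> closure {c..\<beta>})"
      using g[of t] unfolding sets by (simp add: has_real_derivative_iff_has_vector_derivative)
  next
    assume "t \<in> closure {\<alpha>..c}" "t \<in> closure {c..\<beta>}"
    then have "t = c" by simp
    then show "f t = g t" "f' t = g' t" using assms(6,7) by simp_all
  qed
qed

text \<open>Negation exchanges positive and negative parts, and with them the two pairs of parameter
  and weight.\<close>

lemma one_zero_solution_uminus:
  assumes "one_zero_solution T1 T2 p q n m b a u"
  shows "one_zero_solution T1 T2 p q m n a b (\<lambda>t. - u t)"
proof -
  obtain u' w where "\<forall>t\<in>{T1..T2}. (u has_real_derivative u' t) (at t within {T1..T2})"
    "continuous_on {T1..T2} u'"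
    "\<forall>t\<in>{T1<..<T2}. ((\<lambda>s. p s * u' s) has_real_derivative w t) (at t)"
    "\<forall>t\<in>{T1<..<T2}. - w t + q t * u t =
      b * n t * signed_part SPlus (u t) - a * m t * signed_part SMinus (u t)"
    "u' T1 = 0" "u' T2 = 0"
    using assms unfolding one_zero_solution_def neumann_solution_def by blast
  then have "neumann_solution T1 T2 p q m n a b (\<lambda>t. - u t)"
    unfolding neumann_solution_def
    by - (rule exI[of _ "\<lambda>t. - u' t"], rule exI[of _ "\<lambda>t. - w t"],
      auto intro!: DERIV_minus continuous_on_minus simp: algebra_simps)
  then show ?thesis using assms unfolding one_zero_solution_def by simp
qed

text \<open>As a real factor the sign can pass from the weight, where it creates a positive value,
  to the parameter, where it selects the half-line.\<close>

primrec sign_factor :: "pm_sign \<Rightarrow> real" where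
  "sign_factor SPlus = 1"
| "sign_factor SMinus = - 1"

lemma signed_part_nonzero_iff: "signed_part \<epsilon> x \<noteq> 0 \<longleftrightarrow> 0 < sign_factor \<epsilon> * x"
  by (cases \<epsilon>) (auto simp: max_def)

lemma mult_sign_factor_in_half_line: "0 \<le> a \<Longrightarrow> a * sign_factor \<epsilon> \<in> signed_half_line \<epsilon>"
  by (cases \<epsilon>) auto

lemma C1_gt_meets_quadrant:
  assumes c: "T1 < c" "c < T2"
    and cont: "continuous_on {T1..T2} p" "continuous_on {T1..T2} q"
      "continuous_on {T1..T2} m" "continuous_on {T1..T2} n"
    and p: "\<And>t. t \<in> {T1..T2} \<Longrightarrow> 0 < p t" and q: "\<And>t. t \<in> {T1..T2} \<Longrightarrow> 0 \<le> q t"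
    and \<sigma>: "\<sigma> \<in> {T1..c}" "0 < sign_factor \<epsilon>2 * n \<sigma>"
    and \<tau>: "\<tau> \<in> {c..T2}" "0 < sign_factor \<epsilon>1 * m \<tau>"
  shows "\<exists>a\<in>signed_half_line \<epsilon>1. \<exists>b\<in>signed_half_line \<epsilon>2. (a, b) \<in> C1_gt T1 T2 p q m n"
proof -
  let ?A = "\<lambda>t. 1 / p t"
  have A: "continuous_on {T1..T2} ?A" using cont(1) p by (force intro!: continuous_intros)
  have left: "continuous_on {T1..c} f" and right: "continuous_on {c..T2} f"
    if "continuous_on {T1..T2} f" for f :: "real \<Rightarrow> real"
    by (rule continuous_on_subset[OF that], use c in auto)+
  have "\<exists>b\<ge>0. \<exists>x y. linear_system ?A (\<lambda>t. q t - b * (sign_factor \<epsilon>2 * n t)) T1 c x y \<and>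
      y T1 = 0 \<and> (\<forall>t\<in>{T1..<c}. 0 < x t) \<and> x c = 0 \<and> y c < 0"
    by (rule principal_eigenfunction_right_Dirichlet[OF c(1) _ _ _ _ _ \<sigma>(1)])
      (use c A cont p q \<sigma>(2) in \<open>auto intro!: left continuous_on_mult_left\<close>)
  then obtain b x1 y1 where b: "0 \<le> b"
    and sys1: "linear_system ?A (\<lambda>t. q t - b * (sign_factor \<epsilon>2 * n t)) T1 c x1 y1"
    and 1: "y1 T1 = 0" "\<forall>t\<in>{T1..<c}. 0 < x1 t" "x1 c = 0" "y1 c < 0" by blast
  have "\<exists>a\<ge>0. \<exists>x y. linear_system ?A (\<lambda>t. q t - a * (sign_factor \<epsilon>1 * m t)) c T2 x y \<and>
      y T2 = 0 \<and> (\<forall>t\<in>{c<..T2}. 0 < x t) \<and> x c = 0 \<and> 0 < y c"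
    by (rule principal_eigenfunction_left_Dirichlet[OF c(2) _ _ _ _ _ \<tau>(1)])
      (use c A cont p q \<tau>(2) in \<open>auto intro!: right continuous_on_mult_left\<close>)
  then obtain a x2 y2 where a: "0 \<le> a"
    and sys2: "linear_system ?A (\<lambda>t. q t - a * (sign_factor \<epsilon>1 * m t)) c T2 x2 y2"
    and 2: "y2 T2 = 0" "\<forall>t\<in>{c<..T2}. 0 < x2 t" "x2 c = 0" "0 < y2 c" by blast
  \<comment> \<open>Since \<open>y1 c < 0 < y2 c\<close>, this factor is positive and makes the
    values of \<open>p u'\<close> from both sides agree at \<open>c\<close>.\<close>
  define k where "k = - y1 c / y2 c"
  have k: "0 < k" "k * y2 c = - y1 c" using 1(4) 2(4) by (auto simp: k_def intro!: divide_neg_pos)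
  define u where "u t = (if t \<in> {T1..c} then (- 1) * x1 t else k * x2 t)" for t
  define v where "v t = (if t \<in> {T1..c} then (- 1) * y1 t else k * y2 t)" for t
  \<comment> \<open>The bracketed coefficients may differ at \<open>c\<close>, but \<open>x1\<close>
    and \<open>x2\<close> vanish there; hence the two branches of \<open>w\<close> agree and
    \<open>v\<close> is differentiable across \<open>c\<close>.\<close>
  define w where "w t = (if t \<in> {T1..c} then (q t - b * (sign_factor \<epsilon>2 * n t)) * ((- 1) * x1 t)
    else (q t - a * (sign_factor \<epsilon>1 * m t)) * (k * x2 t))" for t
  note sys1' = linear_systemD[OF linear_system_scale[OF sys1, of "- 1"]]
  note sys2' = linear_systemD[OF linear_system_scale[OF sys2, of k]]
  have u_der: "(u has_real_derivative v t / p t) (at t within {T1..T2})" if "t \<in> {T1..T2}" for t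
  proof -
    have "(u has_real_derivative (if t \<in> {T1..c} then ?A t * (- 1 * y1 t) else ?A t * (k * y2 t)))
        (at t within {T1..T2})"
      unfolding u_def
      by (rule has_real_derivative_glue[OF that _ _ sys1'(1) sys2'(1)]) (use c 1 2 k in auto)
    moreover have "(if t \<in> {T1..c} then ?A t * (- 1 * y1 t) else ?A t * (k * y2 t)) = v t / p t"
      by (simp add: v_def)
    ultimately show ?thesis by simp
  qed
  have v_der: "(v has_real_derivative w t) (at t within {T1..T2})" if "t \<in> {T1..T2}" for t
    unfolding v_def w_def
    by (rule has_real_derivative_glue[OF that _ _ sys1'(2) sys2'(2)]) (use c 1 2 k in auto)
  have neg: "u t < 0" if "t \<in> {T1..<c}" for t using 1 that by (auto simp: u_def)
  have pos: "0 < u t" if "t \<in> {c<..T2}" for t using 2 k that by (auto simp: u_def)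
  have zero: "u c = 0" using 1 c by (simp add: u_def)
  have "neumann_solution T1 T2 p q m n (a * sign_factor \<epsilon>1) (b * sign_factor \<epsilon>2) u"
    unfolding neumann_solution_def
  proof (rule exI[of _ "\<lambda>t. v t / p t"], rule exI[of _ w], intro conjI ballI)
    show "(u has_real_derivative v t / p t) (at t within {T1..T2})" if "t \<in> {T1..T2}" for t
      using u_der[OF that] .
    have "continuous_on {T1..T2} v"
      using v_der DERIV_continuous by (metis continuous_on_eq_continuous_within)
    then show "continuous_on {T1..T2} (\<lambda>t. v t / p t)"
      using cont(1) p by (force intro!: continuous_intros)
    show "v T1 / p T1 = 0" "v T2 / p T2 = 0" using 1 2 c by (auto simp: v_def)
  next
    fix t assume t: "t \<in> {T1<..<T2}"
    have "(v has_real_derivative w t) (at t)"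
      using v_der[of t] t at_within_interior[of t "{T1..T2}"] by auto
    \<comment> \<open>The product equals \<open>v\<close> only where \<open>p\<close> is nonzero, so
      the derivative is transferred on the open interval.\<close>
    then show "((\<lambda>s. p s * (v s / p s)) has_real_derivative w t) (at t)"
    proof (rule has_field_derivative_transform_within_open[where S = "{T1<..<T2}"])
      show "v s = p s * (v s / p s)" if "s \<in> {T1<..<T2}" for s using p[of s] that by simp
    qed (use t in auto)
    show "- w t + q t * u t = a * sign_factor \<epsilon>1 * m t * signed_part SPlus (u t)
        - b * sign_factor \<epsilon>2 * n t * signed_part SMinus (u t)"
    proof (cases "t \<le> c")
      case True
      then have "u t \<le> 0" using neg[of t] zero t by (cases "t = c") auto
      moreover have "w t = (q t - b * (sign_factor \<epsilon>2 * n t)) * u t"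
        using True t by (simp add: w_def u_def)
      moreover have "signed_part SPlus (u t) = 0" "signed_part SMinus (u t) = - u t"
        using \<open>u t \<le> 0\<close> by auto
      ultimately show ?thesis by (simp only:) (simp add: algebra_simps)
    next
      case False
      then have "0 < u t" using pos[of t] t by auto
      moreover have "w t = (q t - a * (sign_factor \<epsilon>1 * m t)) * u t"
        using False t by (simp add: w_def u_def)
      ultimately show ?thesis by (simp add: max_def algebra_simps)
    qed
  qed
  moreover have "\<exists>!t. t \<in> {T1<..<T2} \<and> u t = 0"
  proof (rule ex1I[of _ c])
    show "t = c" if "t \<in> {T1<..<T2} \<and> u t = 0" for t
      using that neg[of t] pos[of t] by (cases t c rule: linorder_cases) auto
  qed (use c zero in auto)
  moreover have "\<exists>t\<in>{T1..T2}. u t \<noteq> 0"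
    using pos[of T2] c by (intro bexI[of _ T2]) auto
  ultimately have "one_zero_solution T1 T2 p q m n (a * sign_factor \<epsilon>1) (b * sign_factor \<epsilon>2) u"
    unfolding one_zero_solution_def by (intro conjI)
  moreover have "0 < u T2" using pos[of T2] c by simp
  ultimately have "(a * sign_factor \<epsilon>1, b * sign_factor \<epsilon>2) \<in> C1_gt T1 T2 p q m n"
    unfolding C1_gt_def by blast
  then show ?thesis using mult_sign_factor_in_half_line[OF a] mult_sign_factor_in_half_line[OF b] by blast
qed

text \<open>Negating the solution swaps the weights and reverses the sign at \<open>T2\<close>; this
  carries the case of exchanged roles back to the original problem.\<close>

lemma C1_lt_swap:
  assumes "(b, a) \<in> C1_gt T1 T2 p q n m"
  shows "(a, b) \<in> C1_lt T1 T2 p q m n"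
proof -
  obtain u where "one_zero_solution T1 T2 p q n m b a u" "u T2 > 0"
    using assms by (auto simp: C1_gt_def)
  then have "one_zero_solution T1 T2 p q m n a b (\<lambda>t. - u t)" "- u T2 < 0"
    using one_zero_solution_uminus by auto
  then show ?thesis unfolding C1_lt_def by blast
qed

section \<open>Choice of the position of the zero\<close>

text \<open>If the two given points coincide, continuity of \<open>f\<close> keeps it positive at a
  nearby point, which replaces the first one.\<close>

lemma distinct_positive_points:
  fixes f g :: "real \<Rightarrow> real"
  assumes "\<alpha> < \<beta>" "continuous_on {\<alpha>..\<beta>} f"
    and x: "x \<in> {\<alpha>..\<beta>}" "0 < f x" and y: "y \<in> {\<alpha>..\<beta>}" "0 < g y"
  obtains x' y' where "x' \<in> {\<alpha>..\<beta>}" "0 < f x'" "y' \<in> {\<alpha>..\<beta>}" "0 < g y'" "x' \<noteq> y'"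
proof (cases "x = y")
  case True
  obtain d where d: "0 < d" "\<And>t. t \<in> {\<alpha>..\<beta>} \<Longrightarrow> \<bar>t - x\<bar> < d \<Longrightarrow> \<bar>f t - f x\<bar> < f x"
    using assms(2) x unfolding continuous_on_iff dist_real_def by meson
  \<comment> \<open>The shift goes to the right unless \<open>x\<close> is the right end; half of
    \<open>d\<close> keeps it within the range of continuity, and the cap keeps it in the
    interval.\<close>
  define x' where "x' = (if x < \<beta> then min \<beta> (x + d / 2) else max \<alpha> (x - d / 2))"
  have x': "x' \<in> {\<alpha>..\<beta>}" "\<bar>x' - x\<bar> < d" "x' \<noteq> x"
    using d(1) x(1) \<open>\<alpha> < \<beta>\<close> unfolding x'_def by (auto simp: abs_less_iff min_def max_def)
  then have "0 < f x'" using d(2)[of x'] by linarith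
  with x' y True show thesis by (intro that[of x' y]) auto
qed (use that x y in blast)

theorem theorem3:
  fixes T1 T2 :: real
    and p q m n :: "real \<Rightarrow> real"
    and \<epsilon>1 \<epsilon>2 :: pm_sign
  assumes "T1 < T2"
    and "continuous_on {T1..T2} p" and "continuous_on {T1..T2} q"
    and "continuous_on {T1..T2} m" and "continuous_on {T1..T2} n"
    and "\<And>t. t \<in> {T1..T2} \<Longrightarrow> p t > 0"
    and "\<And>t. t \<in> {T1..T2} \<Longrightarrow> q t \<ge> 0"
    and "\<exists>t\<in>{T1..T2}. m t \<noteq> 0"
    and "\<exists>t\<in>{T1..T2}. n t \<noteq> 0"
    and "\<exists>t\<in>{T1..T2}. signed_part \<epsilon>1 (m t) \<noteq> 0"
    and "\<exists>t\<in>{T1..T2}. signed_part \<epsilon>2 (n t) \<noteq> 0"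
  shows "C1_gt T1 T2 p q m n \<inter> (signed_half_line \<epsilon>1 \<times> signed_half_line \<epsilon>2) \<noteq> {} \<or>
         C1_lt T1 T2 p q m n \<inter> (signed_half_line \<epsilon>1 \<times> signed_half_line \<epsilon>2) \<noteq> {}"
proof -
  obtain x0 y0 where x0: "x0 \<in> {T1..T2}" "0 < sign_factor \<epsilon>1 * m x0"
    and y0: "y0 \<in> {T1..T2}" "0 < sign_factor \<epsilon>2 * n y0"
    using assms(10,11) unfolding signed_part_nonzero_iff by blast
  obtain x y where x: "x \<in> {T1..T2}" "0 < sign_factor \<epsilon>1 * m x"
    and y: "y \<in> {T1..T2}" "0 < sign_factor \<epsilon>2 * n y" and "x \<noteq> y"
    by (rule distinct_positive_points[where f = "\<lambda>t. sign_factor \<epsilon>1 * m t"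
          and g = "\<lambda>t. sign_factor \<epsilon>2 * n t", OF assms(1) continuous_on_mult_left[OF assms(4)] x0 y0])
  \<comment> \<open>The midpoint separates the two distinct points and is therefore interior to the
    interval.\<close>
  define c where "c = (x + y) / 2"
  show ?thesis
  proof (cases "y < x")
    case True
    then have "\<exists>a\<in>signed_half_line \<epsilon>1. \<exists>b\<in>signed_half_line \<epsilon>2. (a, b) \<in> C1_gt T1 T2 p q m n"
      using C1_gt_meets_quadrant[of T1 c T2 p q m n y \<epsilon>2 x \<epsilon>1] assms(2-7) x y
      by (auto simp: c_def)
    then show ?thesis by blast
  next
    case False
    \<comment> \<open>Here the positive point of the signed \<open>m\<close> lies to the left of
      \<open>c\<close>, so the construction is applied with the two weights exchanged.\<close>
    then have "\<exists>b\<in>signed_half_line \<epsilon>2. \<exists>a\<in>signed_half_line \<epsilon>1. (b, a) \<in> C1_gt T1 T2 p q n m"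
      using C1_gt_meets_quadrant[of T1 c T2 p q n m x \<epsilon>1 y \<epsilon>2] assms(2-7) x y \<open>x \<noteq> y\<close>
      by (auto simp: c_def)
    then show ?thesis using C1_lt_swap by blast
  qed
qed

end
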